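(* The brute force algorithm (described in the context) computes the values of $\Vert n\Vert$ for $1\le n\le N$ in time $O(N^2)$ and space $O(N\log^2 N)$.
   Context: For a positive integer $n$, the complexity $\Vert n\Vert$ is the least number of $1$'s needed to express $n$ using only $+$, $\times$ and parentheses. Thus $\Vert 1\Vert=1$ and for $n\ge2$, $\Vert n\Vert$ is the minimum of $\Vert a\Vert+\Vert b\Vert$ over positive integers $a,b<n$ with $a+b=n$ or $ab=n$. Time is the number of elementary operations (arithmetic operations and comparisons on integers, reads and writes of array entries); space is measured in bits. Brute force algorithm, with input $N$. First, a list of all the divisors of every $n\le N$ is built and stored: each list starts as $(1)$, and for $k=2,\dots,N$, $k$ is appended to the list of every multiple $m\le N$ of $k$. Put $\mathrm{Compl}[1]=1$. Then for $n=2,\dots,N$ in increasing order compute $$S=\min_{1\le k\le n/2}\bigl(\mathrm{Compl}[k]+\mathrm{Compl}[n-k]\bigr),\qquad P=\min_{d\mid n,\ 1<d<n}\bigl(\mathrm{Compl}[d]+\mathrm{Compl}[n/d]\bigr)$$ by running over all $k$ and over all stored divisors $d$ of $n$ respectively (with $P=N+1$ if $n$ is prime), and put $\mathrm{Compl}[n]=\min(S,P)$. The output is $\mathrm{Compl}[n]=\Vert n\Vert$ for $1\le n\le N$. *)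

theory Defs
  imports "HOL-Library.Finite_Map" "HOL-Library.Log_Nat" "HOL-Library.Landau_Symbols"
begin

section \<open>Integer complexity\<close>

datatype ones_expr = One | Add ones_expr ones_expr | Mul ones_expr ones_expr

primrec expr_value :: "ones_expr \<Rightarrow> nat" where
  "expr_value One = 1"
| "expr_value (Add a b) = expr_value a + expr_value b"
| "expr_value (Mul a b) = expr_value a * expr_value b"

primrec num_ones :: "ones_expr \<Rightarrow> nat" where
  "num_ones One = 1"
| "num_ones (Add a b) = num_ones a + num_ones b"
| "num_ones (Mul a b) = num_ones a + num_ones b"

definition complexity :: "nat \<Rightarrow> nat" where
  "complexity n = (LEAST k. \<exists>e. expr_value e = n \<and> num_ones e = k)"


section \<open>An imperative language with time and space\<close>

text \<open>
  A memory cell is addressed by a name and a list of indices: no index for a scalar variable,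
  one for an entry of an array, two for an entry of an array of lists.  A store records the
  cells written so far.  All values are nonnegative integers.
\<close>

type_synonym cell = "string \<times> nat list"
type_synonym store = "(cell, nat) fmap"

datatype aexp = Num nat | Cell string "aexp list"
  | Plus aexp aexp | Minus aexp aexp | Times aexp aexp | Div aexp aexp

datatype bexp = Less aexp aexp | Leq aexp aexp

datatype com = Skip | Assign string "aexp list" aexp | Seq com com
  | If bexp com com | While bexp com

text \<open>
  A cell that was never written has the unspecified content \<^term>\<open>the None :: nat\<close>, so
  nothing can be proved about a program that depends on such a cell.
\<close>

primrec aval :: "store \<Rightarrow> aexp \<Rightarrow> nat" where
  "aval s (Num c) = c"
| "aval s (Cell x is) = the (fmlookup s (x, map (aval s) is))"
| "aval s (Plus a b) = aval s a + aval s b"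
| "aval s (Minus a b) = aval s a - aval s b"
| "aval s (Times a b) = aval s a * aval s b"
| "aval s (Div a b) = aval s a div aval s b"

primrec bval :: "store \<Rightarrow> bexp \<Rightarrow> bool" where
  "bval s (Less a b) \<longleftrightarrow> aval s a < aval s b"
| "bval s (Leq a b) \<longleftrightarrow> aval s a \<le> aval s b"

text \<open>
  Every arithmetic operation and every comparison costs one unit, and so does every array
  access.  An entry of an array of lists is reached by two accesses, the first of which
  fetches the list.
\<close>

primrec acost :: "aexp \<Rightarrow> nat" where
  "acost (Num c) = 0"
| "acost (Cell x is) = sum_list (map acost is) + length is"
| "acost (Plus a b) = acost a + acost b + 1"
| "acost (Minus a b) = acost a + acost b + 1"
| "acost (Times a b) = acost a + acost b + 1"
| "acost (Div a b) = acost a + acost b + 1"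

primrec bcost :: "bexp \<Rightarrow> nat" where
  "bcost (Less a b) = acost a + acost b + 1"
| "bcost (Leq a b) = acost a + acost b + 1"

text \<open>The length of the binary representation; the number 0 occupies one bit.\<close>

definition bits :: "nat \<Rightarrow> nat" where
  "bits n = max 1 (floorlog 2 n)"

definition store_bits :: "store \<Rightarrow> nat" where
  "store_bits s = (\<Sum>l\<in>fmdom' s. bits (the (fmlookup s l)))"

text \<open>
  \<open>exec c s t m s'\<close>: started in the store \<open>s\<close>, the command \<open>c\<close> terminates in the store
  \<open>s'\<close> after \<open>t\<close> elementary operations, and \<open>m\<close> is the largest number of bits occupied
  by the store at any moment of the execution.
\<close>

inductive exec :: "com \<Rightarrow> store \<Rightarrow> nat \<Rightarrow> nat \<Rightarrow> store \<Rightarrow> bool" where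
  Skip: "exec Skip s 0 (store_bits s) s"
| Assign: "s' = fmupd (x, map (aval s) is) (aval s a) s \<Longrightarrow>
    exec (Assign x is a) s (acost a + sum_list (map acost is) + length is)
      (max (store_bits s) (store_bits s')) s'"
| Seq: "exec c1 s t1 m1 s1 \<Longrightarrow> exec c2 s1 t2 m2 s2 \<Longrightarrow>
    exec (Seq c1 c2) s (t1 + t2) (max m1 m2) s2"
| IfTrue: "bval s b \<Longrightarrow> exec c1 s t m s' \<Longrightarrow> exec (If b c1 c2) s (bcost b + t) m s'"
| IfFalse: "\<not> bval s b \<Longrightarrow> exec c2 s t m s' \<Longrightarrow> exec (If b c1 c2) s (bcost b + t) m s'"
| WhileFalse: "\<not> bval s b \<Longrightarrow> exec (While b c) s (bcost b) (store_bits s) s"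
| WhileTrue: "bval s b \<Longrightarrow> exec c s t1 m1 s1 \<Longrightarrow> exec (While b c) s1 t2 m2 s2 \<Longrightarrow>
    exec (While b c) s (bcost b + t1 + t2) (max m1 m2) s2"

inductive_cases exec_SkipE: "exec Skip s t m s'"
inductive_cases exec_AssignE: "exec (Assign x is a) s t m s'"
inductive_cases exec_SeqE: "exec (Seq c1 c2) s t m s'"
inductive_cases exec_IfE: "exec (If b c1 c2) s t m s'"
inductive_cases exec_WhileE: "exec (While b c) s t m s'"

text \<open>Time, space and result of a terminating execution are uniquely determined.\<close>

lemma exec_deterministic:
  "exec c s t m s1 \<Longrightarrow> exec c s t' m' s2 \<Longrightarrow> t' = t \<and> m' = m \<and> s2 = s1"
proof (induction arbitrary: t' m' s2 rule: exec.induct)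
  case (Skip s)
  then show ?case by (auto elim: exec_SkipE)
next
  case (Assign s' x s "is" a)
  then show ?case by (auto elim: exec_AssignE)
next
  case (Seq c1 s t1 m1 s1 c2 t2 m2 s2)
  from Seq.prems show ?case by (rule exec_SeqE) (use Seq.IH in blast)
next
  case (IfTrue s b c1 t m s' c2)
  from IfTrue.prems show ?case by (rule exec_IfE) (use IfTrue in blast)+
next
  case (IfFalse s b c2 t m s' c1)
  from IfFalse.prems show ?case by (rule exec_IfE) (use IfFalse in blast)+
next
  case (WhileFalse s b c)
  from WhileFalse.prems show ?case by (rule exec_WhileE) (use WhileFalse in auto)
next
  case (WhileTrue s b c t1 m1 s1 t2 m2 s2)
  from WhileTrue.prems show ?case by (rule exec_WhileE) (use WhileTrue in blast)+
qed


section \<open>The brute force algorithm\<close>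

abbreviation Var :: "string \<Rightarrow> aexp" where
  "Var x \<equiv> Cell x []"

abbreviation set_var :: "string \<Rightarrow> aexp \<Rightarrow> com"  ("_ ::= _" [1000, 61] 61) where
  "x ::= a \<equiv> Assign x [] a"

abbreviation seq :: "com \<Rightarrow> com \<Rightarrow> com"  (infixr ";;" 60) where
  "c1 ;; c2 \<equiv> Seq c1 c2"

text \<open>
  The list of divisors of \<open>m\<close> is kept as the entries with indices \<open>0, \<dots>, Len[m] - 1\<close>
  of \<open>Divs[m]\<close>.
\<close>

definition build_divisor_lists :: com where
  "build_divisor_lists =
    ''m'' ::= Num 1 ;;
    While (Leq (Var ''m'') (Var ''N'')) (
      Assign ''Divs'' [Var ''m'', Num 0] (Num 1) ;;
      Assign ''Len'' [Var ''m''] (Num 1) ;;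
      ''m'' ::= Plus (Var ''m'') (Num 1)) ;;
    ''k'' ::= Num 2 ;;
    While (Leq (Var ''k'') (Var ''N'')) (
      ''m'' ::= Var ''k'' ;;
      While (Leq (Var ''m'') (Var ''N'')) (
        Assign ''Divs'' [Var ''m'', Cell ''Len'' [Var ''m'']] (Var ''k'') ;;
        Assign ''Len'' [Var ''m''] (Plus (Cell ''Len'' [Var ''m'']) (Num 1)) ;;
        ''m'' ::= Plus (Var ''m'') (Var ''k'')) ;;
      ''k'' ::= Plus (Var ''k'') (Num 1))"

text \<open>The running minimum \<open>S\<close> starts with the term for \<open>k = 1\<close>.\<close>

definition compute_S :: com where
  "compute_S =
    ''S'' ::= Plus (Cell ''Compl'' [Num 1]) (Cell ''Compl'' [Minus (Var ''n'') (Num 1)]) ;;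
    ''k'' ::= Num 2 ;;
    While (Leq (Var ''k'') (Div (Var ''n'') (Num 2))) (
      ''t'' ::= Plus (Cell ''Compl'' [Var ''k''])
                     (Cell ''Compl'' [Minus (Var ''n'') (Var ''k'')]) ;;
      If (Less (Var ''t'') (Var ''S'')) (''S'' ::= Var ''t'') Skip ;;
      ''k'' ::= Plus (Var ''k'') (Num 1))"

definition compute_P :: com where
  "compute_P =
    ''P'' ::= Plus (Var ''N'') (Num 1) ;;
    ''i'' ::= Num 0 ;;
    While (Less (Var ''i'') (Cell ''Len'' [Var ''n''])) (
      ''d'' ::= Cell ''Divs'' [Var ''n'', Var ''i''] ;;
      If (Less (Num 1) (Var ''d'')) (
        If (Less (Var ''d'') (Var ''n'')) (
          ''t'' ::= Plus (Cell ''Compl'' [Var ''d''])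
                         (Cell ''Compl'' [Div (Var ''n'') (Var ''d'')]) ;;
          If (Less (Var ''t'') (Var ''P'')) (''P'' ::= Var ''t'') Skip)
        Skip)
      Skip ;;
      ''i'' ::= Plus (Var ''i'') (Num 1))"

definition brute_force :: com where
  "brute_force =
    build_divisor_lists ;;
    Assign ''Compl'' [Num 1] (Num 1) ;;
    ''n'' ::= Num 2 ;;
    While (Leq (Var ''n'') (Var ''N'')) (
      compute_S ;;
      compute_P ;;
      If (Less (Var ''S'') (Var ''P''))
        (Assign ''Compl'' [Var ''n''] (Var ''S''))
        (Assign ''Compl'' [Var ''n''] (Var ''P'')) ;;
      ''n'' ::= Plus (Var ''n'') (Num 1))"

definition input_store :: "nat \<Rightarrow> store" where
  "input_store N = fmupd (''N'', []) N fmempty"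

end

theory Submission
  imports Defs "HOL-Analysis.Harmonic_Numbers" "HOL-Real_Asymp.Real_Asymp"
begin

text \<open>
  The list of \<open>m\<close> has one entry per divisor of \<open>m\<close>, so all lists together occupy
  \<open>(\<Sum>d\<le>N. \<lfloor>N / d\<rfloor>) = O(N log N)\<close> cells, and every value that the program stores is at most
  \<open>2 * N + 1\<close>, hence has \<open>O(log N)\<close> bits.  For the time it suffices that each inner loop
  runs at most \<open>N\<close> times.
\<close>

section \<open>Integer complexity\<close>

text \<open>The space of a run is a maximum over all its moments, so it cannot be read off the final
  store: every intermediate store has to be bounded. One set of cells and one bound on values, both
  fixed by \<open>N\<close> before the run starts, are carried by every loop invariant; the space
  bound then holds at each assignment, and only the time has to be added up. Since the content of an
  unwritten cell is unspecified, the invariants must also supply the content of each cell that is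
  read. For correctness \<open>S\<close> and \<open>P\<close> need not be exact minima: both are at
  least \<open>complexity n\<close>, and an optimal expression for \<open>n\<close> is at the top a
  sum or a proper product, whose term one of the two loops has examined.\<close>

lemma expr_value_pos: "expr_value e > 0"
  by (induction e) auto

text \<open>Ensures that the \<open>LEAST\<close> in \<open>complexity n\<close> is attained for
  \<open>n > 0\<close>. No expression has the value 0, so \<open>complexity 0\<close> is
  unspecified, whence the positivity assumptions on operands.\<close>

lemma ex_expr_value: "n > 0 \<Longrightarrow> \<exists>e. expr_value e = n"
proof (induction n rule: nat_induct_non_zero)
  case 1
  show ?case by (rule exI[of _ ones_expr.One]) simp
next
  case (Suc n)
  then obtain e where "expr_value e = n" by blast
  then show ?case by (intro exI[of _ "Add e ones_expr.One"]) simp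
qed

lemma complexity_le: "expr_value e = n \<Longrightarrow> complexity n \<le> num_ones e"
  unfolding complexity_def by (rule Least_le) blast

lemma complexity_witness:
  assumes "n > 0"
  obtains e where "expr_value e = n" "num_ones e = complexity n"
proof -
  from ex_expr_value[OF assms] have "\<exists>k e. expr_value e = n \<and> num_ones e = k" by blast
  from LeastI_ex[OF this] that show ?thesis unfolding complexity_def by blast
qed

lemma num_ones_pos: "num_ones e > 0"
  by (induction e) auto

lemma complexity_1: "complexity 1 = 1"
proof -
  have "complexity 1 \<le> 1" using complexity_le[of ones_expr.One 1] by simp
  moreover obtain e where "num_ones e = complexity 1" by (rule complexity_witness[of 1]) auto
  ultimately show ?thesis using num_ones_pos[of e] by simp
qed

lemma complexity_add_le:
  assumes "a > 0" "b > 0" shows "complexity (a + b) \<le> complexity a + complexity b"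
proof -
  obtain d e where "expr_value d = a" "num_ones d = complexity a"
    "expr_value e = b" "num_ones e = complexity b"
    by (meson assms complexity_witness)
  then show ?thesis using complexity_le[of "Add d e"] by simp
qed

lemma complexity_mult_le:
  assumes "a > 0" "b > 0" shows "complexity (a * b) \<le> complexity a + complexity b"
proof -
  obtain d e where "expr_value d = a" "num_ones d = complexity a"
    "expr_value e = b" "num_ones e = complexity b"
    by (meson assms complexity_witness)
  then show ?thesis using complexity_le[of "Mul d e"] by simp
qed

text \<open>Adding up \<open>n\<close> ones is one way to write \<open>n\<close>. This keeps the
  table entries at most \<open>N\<close> and lets the start value \<open>N + 1\<close> of
  \<open>P\<close> act as infinity.\<close>

lemma complexity_le_self: "n > 0 \<Longrightarrow> complexity n \<le> n"
proof (induction n rule: nat_induct_non_zero)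
  case (Suc n)
  then show ?case using complexity_add_le[of n 1] complexity_1 by simp
qed (use complexity_1 in simp)

text \<open>A factor \<open>1\<close> in an optimal expression could be dropped, so an optimal product is proper.\<close>

lemma complexity_cases:
  assumes "n \<ge> 2"
  obtains (add) k where "1 \<le> k" "k \<le> n div 2" "complexity n = complexity k + complexity (n - k)"
  | (mult) d where "1 < d" "d < n" "d dvd n" "complexity n = complexity d + complexity (n div d)"
proof -
  obtain e where e: "expr_value e = n" "num_ones e = complexity n"
    using complexity_witness[of n] assms by auto
  show thesis
  proof (cases e)
    case One
    with e assms show ?thesis by simp
  next
    case (Add a b)
    define x y where "x = expr_value a" and "y = expr_value b"
    have n: "n = x + y" and pos: "x > 0" "y > 0"
      using e Add expr_value_pos by (auto simp: x_def y_def)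
    have "complexity n \<le> complexity x + complexity y"
      using complexity_add_le pos n by simp
    \<comment> \<open>The ones of the optimal \<open>e\<close> are split between \<open>a\<close>
      and \<open>b\<close>, and neither operand can beat its own complexity.\<close>
    moreover have "complexity x + complexity y \<le> complexity n"
      using e Add complexity_le[of a x] complexity_le[of b y] by (simp add: x_def y_def)
    ultimately have eq: "complexity n = complexity x + complexity y" by simp
    \<comment> \<open>The smaller summand serves as \<open>k\<close>, which is why half of the range
      of \<open>k\<close> suffices.\<close>
    show ?thesis
    proof (cases "x \<le> y")
      case True
      show ?thesis by (rule add[of x]) (use n pos eq True in auto)
    next
      case False
      show ?thesis by (rule add[of y]) (use n pos eq False in auto)
    qed
  next
    case (Mul a b)
    define x y where "x = expr_value a" and "y = expr_value b"
    have n: "n = x * y" and pos: "x > 0" "y > 0"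
      using e Mul expr_value_pos by (auto simp: x_def y_def)
    have "complexity n \<le> complexity x + complexity y"
      using complexity_mult_le pos n by simp
    moreover have "complexity x + complexity y \<le> complexity n"
      using e Mul complexity_le[of a x] complexity_le[of b y] by (simp add: x_def y_def)
    ultimately have eq: "complexity n = complexity x + complexity y" by simp
    have "x \<noteq> 1" "y \<noteq> 1"
      using e Mul n complexity_le[of a n] complexity_le[of b n] num_ones_pos[of a] num_ones_pos[of b]
      by (auto simp: x_def y_def)
    with pos have "1 < x" "1 < y" by auto
    then show ?thesis using mult[of x] n eq by simp
  qed
qed

section \<open>A weakest precondition calculus\<close>

text \<open>Space combines by maximum, so one bound \<open>M\<close> passes unchanged to all parts
  of a program; time combines by addition, so it is an argument of the postcondition. The
  existential includes termination, and as \<open>exec\<close> is deterministic it speaks of the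
  only run.\<close>

definition wp :: "nat \<Rightarrow> com \<Rightarrow> (nat \<Rightarrow> store \<Rightarrow> bool) \<Rightarrow> store \<Rightarrow> bool" where
  "wp M c Q s \<longleftrightarrow> (\<exists>t m s'. exec c s t m s' \<and> m \<le> M \<and> Q t s')"

lemma wp_Skip: "wp M Skip Q s \<longleftrightarrow> store_bits s \<le> M \<and> Q 0 s"
  unfolding wp_def by (blast intro: exec.Skip elim: exec_SkipE)

lemma wp_Assign:
  "wp M (Assign x is a) Q s \<longleftrightarrow>
    store_bits s \<le> M \<and> store_bits (fmupd (x, map (aval s) is) (aval s a) s) \<le> M \<and>
    Q (acost a + sum_list (map acost is) + length is) (fmupd (x, map (aval s) is) (aval s a) s)"
  unfolding wp_def by (fastforce intro: exec.Assign elim: exec_AssignE)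

lemma wp_Seq: "wp M (c1 ;; c2) Q = wp M c1 (\<lambda>t. wp M c2 (\<lambda>t'. Q (t + t')))"
  unfolding wp_def fun_eq_iff by (fastforce intro: exec.Seq elim: exec_SeqE)

lemma wp_If:
  "wp M (If b c1 c2) Q s \<longleftrightarrow>
    (if bval s b then wp M c1 (\<lambda>t. Q (bcost b + t)) s else wp M c2 (\<lambda>t. Q (bcost b + t)) s)"
  unfolding wp_def by (auto intro: exec.IfTrue exec.IfFalse elim!: exec_IfE)

lemmas wp_simps = wp_Skip wp_Assign wp_Seq wp_If

lemma wp_mono: "wp M c Q s \<Longrightarrow> (\<And>t s'. Q t s' \<Longrightarrow> R t s') \<Longrightarrow> wp M c R s"
  unfolding wp_def by blast

text \<open>\<open>C\<close> pays for one guard and one body; \<open>J - j\<close> bounds the rounds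
  left and is thus the termination measure. The extra \<open>bcost b\<close> is the last, failing
  test, and \<open>space\<close> covers the store in which that test happens.\<close>

lemma wp_While:
  assumes "I j s"
    and space: "\<And>j s. I j s \<Longrightarrow> store_bits s \<le> M"
    and step: "\<And>j s. I j s \<Longrightarrow> bval s b \<Longrightarrow>
      j < J \<and> wp M c (\<lambda>t s'. bcost b + t \<le> C \<and> I (Suc j) s') s"
    and post: "\<And>j' t s'. I j' s' \<Longrightarrow> \<not> bval s' b \<Longrightarrow> t \<le> C * (J - j) + bcost b \<Longrightarrow> Q t s'"
  shows "wp M (While b c) Q s"
proof -
  \<comment> \<open>\<open>post\<close> measures time from the given \<open>j\<close> only. The
    induction passes to later counters, so the time bound itself has to be the
    postcondition.\<close>
  have "wp M (While b c) (\<lambda>t s'. t \<le> C * (J - j) + bcost b \<and> (\<exists>j'. I j' s' \<and> \<not> bval s' b)) s"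
    using assms(1)
  proof (induction "J - j" arbitrary: j s rule: less_induct)
    case less
    show ?case
    proof (cases "bval s b")
      case False
      with less.prems space show ?thesis
        unfolding wp_def by (fastforce intro: exec.WhileFalse)
    next
      case True
      with step[OF less.prems] obtain t m s' where
        j: "j < J" and e: "exec c s t m s'" "m \<le> M" "bcost b + t \<le> C" "I (Suc j) s'"
        unfolding wp_def by blast
      have "wp M (While b c)
          (\<lambda>t s'. t \<le> C * (J - Suc j) + bcost b \<and> (\<exists>j'. I j' s' \<and> \<not> bval s' b)) s'"
        by (rule less.hyps) (use j e in auto)
      then obtain t' m' s'' j'' where
        e': "exec (While b c) s' t' m' s''" "m' \<le> M" "t' \<le> C * (J - Suc j) + bcost b"
          "I j'' s''" "\<not> bval s'' b"
        unfolding wp_def by blast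
      have "C + C * (J - Suc j) = C * (J - j)"
        using j by (metis Suc_diff_Suc mult_Suc_right)
      with e e' have "bcost b + t + t' \<le> C * (J - j) + bcost b" by simp
      moreover have "exec (While b c) s (bcost b + t + t') (max m m') s''"
        using exec.WhileTrue True e e' by blast
      ultimately show ?thesis using e e' unfolding wp_def by (metis max.bounded_iff)
    qed
  qed
  then show ?thesis by (rule wp_mono) (use post in blast)
qed

section \<open>The memory used by the algorithm\<close>

text \<open>The list of \<open>m\<close> when the sieve is about to process \<open>k\<close>;
  increasing order is the order of appending. For \<open>k = Suc N\<close> and \<open>m\<close>
  between 1 and \<open>N\<close> it is complete.\<close>

definition divisors_below :: "nat \<Rightarrow> nat \<Rightarrow> nat list" where
  "divisors_below k m = filter (\<lambda>d. d dvd m) [1..<k]"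

lemma divisors_below_Suc:
  "k > 0 \<Longrightarrow> divisors_below (Suc k) m = divisors_below k m @ (if k dvd m then [k] else [])"
  by (simp add: divisors_below_def)

lemma divisors_below_2: "divisors_below 2 m = [1]"
  by (simp add: divisors_below_def numeral_2_eq_2)

lemma length_divisors_below_mono:
  assumes "1 \<le> k" "k \<le> l"
  shows "length (divisors_below k m) \<le> length (divisors_below l m)"
proof -
  have "[1..<l] = [1..<k] @ [k..<l]" using assms upt_add_eq_append[of 1 k "l - k"] by simp
  then show ?thesis by (simp add: divisors_below_def)
qed

lemma length_divisors_below_le: "length (divisors_below k m) \<le> k - 1"
  unfolding divisors_below_def by (rule order.trans[OF length_filter_le]) simp

text \<open>The position at which \<open>k\<close> is about to be appended is therefore one that the
  finished list occupies, hence in \<open>cells N\<close> for \<open>m\<close> in range.\<close>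

lemma length_divisors_below_less:
  assumes "1 \<le> k" "k \<le> N" "k dvd m"
  shows "length (divisors_below k m) < length (divisors_below (Suc N) m)"
  using length_divisors_below_mono[of "Suc k" "Suc N" m] assms by (simp add: divisors_below_Suc)

lemma divisors_below_nth:
  assumes "i < length (divisors_below k m)"
  shows "1 \<le> divisors_below k m ! i" "divisors_below k m ! i < k" "divisors_below k m ! i dvd m"
  using nth_mem[OF assms] by (auto simp: divisors_below_def)

lemma divisors_below_index:
  assumes "1 \<le> d" "d < k" "d dvd m"
  obtains i where "i < length (divisors_below k m)" "divisors_below k m ! i = d"
proof -
  have "d \<in> set (divisors_below k m)" using assms by (auto simp: divisors_below_def)
  then show ?thesis using that by (auto simp: in_set_conv_nth)
qed

text \<open>An upper bound for the domain of the store at all times. The range of \<open>i\<close>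
  depends on \<open>m\<close> through the final list length; a uniform range up to \<open>N\<close>
  would give quadratically many cells.\<close>

definition cells :: "nat \<Rightarrow> cell set" where
  "cells N =
    (\<lambda>x. (x, [])) ` {''N'', ''m'', ''k'', ''S'', ''P'', ''t'', ''i'', ''d'', ''n''} \<union>
    (\<lambda>n. (''Len'', [n])) ` {1..N} \<union> (\<lambda>n. (''Compl'', [n])) ` {1..N} \<union>
    (\<lambda>(m, i). (''Divs'', [m, i])) ` (SIGMA m:{1..N}. {..<length (divisors_below (Suc N) m)})"

lemma finite_cells: "finite (cells N)"
  unfolding cells_def by (intro finite_UnI finite_imageI finite_SigmaI) auto

lemma cells_simps [simp]:
  "(x, []) \<in> cells N \<longleftrightarrow> x \<in> {''N'', ''m'', ''k'', ''S'', ''P'', ''t'', ''i'', ''d'', ''n''}"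
  "(''Len'', [n]) \<in> cells N \<longleftrightarrow> 1 \<le> n \<and> n \<le> N"
  "(''Compl'', [n]) \<in> cells N \<longleftrightarrow> 1 \<le> n \<and> n \<le> N"
  "(''Divs'', [m, i]) \<in> cells N \<longleftrightarrow>
    1 \<le> m \<and> m \<le> N \<and> i < length (divisors_below (Suc N) m)"
  unfolding cells_def by (auto simp: image_iff)

text \<open>Double counting of the pairs of \<open>d\<close> and \<open>m\<close> with
  \<open>d dvd m\<close>: there are \<open>N div d\<close> multiples of \<open>d\<close> up to
  \<open>N\<close>.\<close>

lemma sum_length_divisors_below:
  "(\<Sum>m=1..N. length (divisors_below (Suc N) m)) = (\<Sum>d=1..N. N div d)"
proof -
  have "length (divisors_below (Suc N) m) = (\<Sum>d=1..N. if d dvd m then 1 else 0)" for m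
  proof -
    have "length (divisors_below (Suc N) m) = card (set (divisors_below (Suc N) m))"
      by (rule distinct_card[symmetric]) (simp add: divisors_below_def)
    also have "set (divisors_below (Suc N) m) = {1..N} \<inter> {d. d dvd m}"
      by (auto simp: divisors_below_def)
    finally show ?thesis by (simp add: sum.If_cases)
  qed
  then have "(\<Sum>m=1..N. length (divisors_below (Suc N) m)) =
      (\<Sum>m=1..N. \<Sum>d=1..N. if d dvd m then 1 else 0)" by simp
  also have "\<dots> = (\<Sum>d=1..N. \<Sum>m=1..N. if d dvd m then 1 else 0)" by (rule sum.swap)
  also have "\<dots> = (\<Sum>d=1..N. N div d)"
  proof (rule sum.cong[OF refl])
    fix d assume d: "d \<in> {1..N}"
    have "{1..N} \<inter> {m. d dvd m} = (\<lambda>q. d * q) ` {1..N div d}"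
    proof (intro equalityI subsetI)
      fix m assume "m \<in> {1..N} \<inter> {m. d dvd m}"
      then obtain q where "m = d * q" "1 \<le> m" "m \<le> N" by auto
      then show "m \<in> (\<lambda>q. d * q) ` {1..N div d}"
        using d by (auto simp: less_eq_div_iff_mult_less_eq mult.commute Suc_le_eq)
    next
      fix m assume "m \<in> (\<lambda>q. d * q) ` {1..N div d}"
      then show "m \<in> {1..N} \<inter> {m. d dvd m}"
        using d by (auto simp: less_eq_div_iff_mult_less_eq mult.commute Suc_le_eq)
    qed
    moreover have "card ((\<lambda>q. d * q) ` {1..N div d}) = N div d"
      using d by (subst card_image) (auto simp: inj_on_def)
    ultimately show "(\<Sum>m=1..N. if d dvd m then 1 else 0) = N div d"
      by (simp add: sum.If_cases)
  qed
  finally show ?thesis .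
qed

lemma card_cells: "card (cells N) \<le> 9 + 2 * N + (\<Sum>d=1..N. N div d)"
proof -
  let ?A = "(\<lambda>x. (x, [])) ` {''N'', ''m'', ''k'', ''S'', ''P'', ''t'', ''i'', ''d'', ''n''} :: cell set"
  let ?B = "(\<lambda>n. (''Len'', [n])) ` {1..N} :: cell set"
  let ?C = "(\<lambda>n. (''Compl'', [n])) ` {1..N} :: cell set"
  let ?D = "(\<lambda>(m, i). (''Divs'', [m, i])) `
    (SIGMA m:{1..N}. {..<length (divisors_below (Suc N) m)}) :: cell set"
  have "card (cells N) \<le> card ?A + card ?B + card ?C + card ?D"
    unfolding cells_def by (intro order.trans[OF card_Un_le] add_mono order.refl)
  moreover have "card ?A \<le> 9" by (rule order.trans[OF card_image_le]) auto
  moreover have "card ?B \<le> N" by (rule order.trans[OF card_image_le]) auto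
  moreover have "card ?C \<le> N" by (rule order.trans[OF card_image_le]) auto
  moreover have "card ?D \<le> (\<Sum>d=1..N. N div d)"
    unfolding sum_length_divisors_below[symmetric]
    by (rule order.trans[OF card_image_le]) auto
  ultimately show ?thesis by linarith
qed

section \<open>Space in bits and its growth\<close>

definition space_bound :: "nat \<Rightarrow> nat" where
  "space_bound N = card (cells N) * bits (2 * N + 1)"

text \<open>The value bound leaves room for the largest values: the sieve moves \<open>m\<close>
  past \<open>N\<close> by at most \<open>k <= N\<close>, and \<open>S\<close> and \<open>t\<close>
  are sums of two complexities. Being kept by each assignment, the predicate discharges both space
  conditions of \<open>wp_Assign\<close>.\<close>

definition bounded_store :: "nat \<Rightarrow> store \<Rightarrow> bool" where
  "bounded_store N s \<longleftrightarrow> fmlookup s (''N'', []) = Some N \<and>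
    fmpred (\<lambda>l v. l \<in> cells N \<and> v \<le> 2 * N + 1) s"

lemma bounded_store_N [simp]: "bounded_store N s \<Longrightarrow> fmlookup s (''N'', []) = Some N"
  by (simp add: bounded_store_def)

lemma bounded_store_update [simp]:
  "bounded_store N s \<Longrightarrow> x \<noteq> ''N'' \<Longrightarrow> (x, is) \<in> cells N \<Longrightarrow> v \<le> 2 * N + 1 \<Longrightarrow>
    bounded_store N (fmupd (x, is) v s)"
  unfolding bounded_store_def by (simp add: fmpred_upd)

lemma bits_mono: "a \<le> b \<Longrightarrow> bits a \<le> bits b"
  unfolding bits_def using floorlog_mono[of a b 2] by simp

lemma store_bits_le [simp]:
  assumes "bounded_store N s"
  shows "store_bits s \<le> space_bound N"
proof -
  have bd: "l \<in> cells N \<and> v \<le> 2 * N + 1" if "fmlookup s l = Some v" for l v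
    using assms that unfolding bounded_store_def by (blast dest: fmpredD)
  have sub: "fmdom' s \<subseteq> cells N"
  proof
    fix l assume "l \<in> fmdom' s"
    then show "l \<in> cells N" using bd unfolding fmlookup_dom'_iff by blast
  qed
  have "store_bits s \<le> (\<Sum>l\<in>fmdom' s. bits (2 * N + 1))"
    unfolding store_bits_def
  proof (rule sum_mono)
    fix l assume "l \<in> fmdom' s"
    then obtain v where "fmlookup s l = Some v" unfolding fmlookup_dom'_iff by blast
    then show "bits (the (fmlookup s l)) \<le> bits (2 * N + 1)" using bd bits_mono by simp
  qed
  also have "\<dots> \<le> space_bound N"
    using card_mono[OF finite_cells sub] by (simp add: space_bound_def)
  finally show ?thesis .
qed

lemma space_bound_le:
  assumes "N \<ge> 1"
  shows "real (space_bound N) \<le>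
    (9 + 2 * real N + real N * (1 + ln (real N))) * (ln (2 * real N + 1) / ln 2 + 1)"
proof -
  have "real (\<Sum>d=1..N. N div d) \<le> (\<Sum>d=1..N. real N / real d)"
    unfolding of_nat_sum by (rule sum_mono) (rule of_nat_div_le_of_nat)
  also have "\<dots> = real N * harm N"
    by (simp add: harm_def sum_distrib_left field_simps)
  \<comment> \<open>\<open>harm n - ln n\<close> is decreasing and equals 1 at
    \<open>n = 1\<close>.\<close>
  also have "\<dots> \<le> real N * (1 + ln (real N))"
    using euler_mascheroni_sequence_decreasing[of 1 N] assms by (intro mult_left_mono) (auto simp: harm_expand)
  finally have "real (card (cells N)) \<le> 9 + 2 * real N + real N * (1 + ln (real N))"
    using card_cells[of N] by linarith
  moreover have "real (bits (2 * N + 1)) \<le> ln (2 * real N + 1) / ln 2 + 1"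
    unfolding bits_def floorlog_def by (simp add: log_def add.commute)
  ultimately show ?thesis
    unfolding space_bound_def of_nat_mult by (intro mult_mono) auto
qed

lemma space_bound_bigo: "(\<lambda>N. real (space_bound N)) \<in> O(\<lambda>N. real N * (ln (real N))\<^sup>2)"
proof -
  have "(\<lambda>N. real (space_bound N)) \<in>
      O(\<lambda>N. (9 + 2 * real N + real N * (1 + ln (real N))) * (ln (2 * real N + 1) / ln 2 + 1))"
    by (intro bigoI[of _ 1] eventually_mono[OF eventually_ge_at_top[of 1]])
       (use space_bound_le in \<open>fastforce intro: order.trans\<close>)
  also have "(\<lambda>N. (9 + 2 * real N + real N * (1 + ln (real N))) * (ln (2 * real N + 1) / ln 2 + 1))
      \<in> O(\<lambda>N. real N * (ln (real N))\<^sup>2)"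
    by real_asymp
  finally show ?thesis .
qed

section \<open>The divisor lists\<close>

text \<open>Both parameters move: \<open>A\<close> grows while the lists are initialised,
  \<open>L\<close> changes while divisors are appended.\<close>

definition lists_stored :: "nat set \<Rightarrow> (nat \<Rightarrow> nat list) \<Rightarrow> store \<Rightarrow> bool" where
  "lists_stored A L s \<longleftrightarrow> (\<forall>m\<in>A. fmlookup s (''Len'', [m]) = Some (length (L m)) \<and>
    (\<forall>i<length (L m). fmlookup s (''Divs'', [m, i]) = Some (L m ! i)))"

lemma lists_stored_update [simp]:
  "x \<noteq> ''Len'' \<Longrightarrow> x \<noteq> ''Divs'' \<Longrightarrow>
    lists_stored A L (fmupd (x, is) v s) \<longleftrightarrow> lists_stored A L s"
  by (auto simp: lists_stored_def)

text \<open>Mirrors the two writes of the program: the new entry goes to the position given by the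
  old length, and only then is the length increased.\<close>

lemma lists_stored_append:
  assumes "lists_stored A L s" "m \<in> A" "L' = L(m := L m @ [d])"
  shows "lists_stored A L'
    (fmupd (''Len'', [m]) (Suc (length (L m))) (fmupd (''Divs'', [m, length (L m)]) d s))"
  using assms unfolding lists_stored_def by (auto simp: nth_append less_Suc_eq)

lemma lists_stored_cong:
  "(\<And>m. m \<in> A \<Longrightarrow> L m = L' m) \<Longrightarrow> lists_stored A L s \<longleftrightarrow> lists_stored A L' s"
  by (simp add: lists_stored_def)

abbreviation divisors_stored :: "nat \<Rightarrow> store \<Rightarrow> bool" where
  "divisors_stored N \<equiv> lists_stored {1..N} (divisors_below (Suc N))"

lemma initialise_lists:
  assumes "bounded_store N s" "N \<ge> 1"
  shows "wp (space_bound N) (''m'' ::= Num 1 ;;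
    While (Leq (Var ''m'') (Var ''N'')) (
      Assign ''Divs'' [Var ''m'', Num 0] (Num 1) ;;
      Assign ''Len'' [Var ''m''] (Num 1) ;;
      ''m'' ::= Plus (Var ''m'') (Num 1)))
    (\<lambda>t s'. t \<le> 10 * N + 1 \<and> bounded_store N s' \<and> lists_stored {1..N} (divisors_below 2) s') s"
proof -
  define I where "I m s \<longleftrightarrow> bounded_store N s \<and> 1 \<le> m \<and> m \<le> N + 1 \<and>
    fmlookup s (''m'', []) = Some m \<and> lists_stored {1..<m} (divisors_below 2) s" for m s
  show ?thesis
    unfolding wp_Seq wp_Assign
  proof (intro conjI, goal_cases)
    case 3
    show ?case
    proof (rule wp_While[where I = I and j = 1 and J = "N + 1" and C = 10], goal_cases)
      case 1
      show ?case using assms by (simp add: I_def) (simp add: lists_stored_def)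
    next
      case (2 m s)
      then show ?case by (simp add: I_def)
    next
      case (3 m s)
      then have m: "1 \<le> m" "m \<le> N" "fmlookup s (''m'', []) = Some m" "bounded_store N s"
        by (auto simp: I_def)
      \<comment> \<open>\<open>1\<close> divides \<open>m\<close>, so position \<open>0\<close> lies
        in the range that \<open>cells N\<close> reserves for \<open>m\<close>.\<close>
      have len: "divisors_below (Suc N) m \<noteq> []"
        using length_divisors_below_mono[of 2 "Suc N" m] m by (auto simp: divisors_below_2)
      have upd: "lists_stored {1..<Suc m} (divisors_below 2)
          (fmupd (''Len'', [m]) 1 (fmupd (''Divs'', [m, 0]) 1 s))"
        using 3 by (auto simp: I_def lists_stored_def less_Suc_eq divisors_below_2)
      show ?case using m len upd by (simp add: wp_simps I_def)
    next
      case (4 m t s)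
      then have "m = N + 1" by (auto simp: I_def)
      with 4 show ?case by (simp add: I_def atLeastLessThanSuc_atLeastAtMost)
    qed
  qed (use assms in auto)
qed

lemma append_divisor:
  assumes "bounded_store N s" "2 \<le> k" "k \<le> N" "fmlookup s (''k'', []) = Some k"
    "lists_stored {1..N} (divisors_below k) s"
  shows "wp (space_bound N) (''m'' ::= Var ''k'' ;;
      While (Leq (Var ''m'') (Var ''N'')) (
        Assign ''Divs'' [Var ''m'', Cell ''Len'' [Var ''m'']] (Var ''k'') ;;
        Assign ''Len'' [Var ''m''] (Plus (Cell ''Len'' [Var ''m'']) (Num 1)) ;;
        ''m'' ::= Plus (Var ''m'') (Var ''k'')))
    (\<lambda>t s'. t \<le> 10 * N + 1 \<and> bounded_store N s' \<and> fmlookup s' (''k'', []) = Some k \<and>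
      lists_stored {1..N} (divisors_below (Suc k)) s') s"
proof -
  \<comment> \<open>The mixed state inside round \<open>k\<close>: numbers below the current
    multiple \<open>q * k\<close> have been dealt with, the others not yet.\<close>
  define L where "L q j = (if j < q * k then divisors_below (Suc k) j else divisors_below k j)" for q j
  define I where "I q s \<longleftrightarrow> bounded_store N s \<and> 1 \<le> q \<and> q * k \<le> N + k \<and>
    fmlookup s (''m'', []) = Some (q * k) \<and> fmlookup s (''k'', []) = Some k \<and>
    lists_stored {1..N} (L q) s" for q s
  \<comment> \<open>Between consecutive multiples of \<open>k\<close> there is no further one, so
    advancing \<open>q\<close> changes the family \<open>L q\<close> at \<open>q * k\<close>
    only.\<close>
  have not_dvd: "\<not> k dvd j" if "q * k < j" "j < k + q * k" for q j
  proof
    assume "k dvd j"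
    then obtain r where "j = r * k" by (metis dvd_def mult.commute)
    with that have "q < r" "r < Suc q" by (simp_all flip: mult_Suc)
    then show False by simp
  qed
  have L1: "L 1 j = divisors_below k j" if "j \<in> {1..N}" for j
    using that assms by (auto simp: L_def divisors_below_Suc dest: dvd_imp_le)
  have LN: "L q j = divisors_below (Suc k) j" if "j \<in> {1..N}" "N < q * k" for q j
    using that by (simp add: L_def)
  have L_Suc: "L (Suc q) = (L q)(q * k := L q (q * k) @ [k])" for q
    using not_dvd[of q] assms by (auto simp: L_def divisors_below_Suc fun_eq_iff)
  show ?thesis
    unfolding wp_Seq wp_Assign
  proof (intro conjI, goal_cases)
    case 3
    show ?case
    proof (rule wp_While[where I = I and j = 1 and J = "N + 1" and C = 10], goal_cases)
      case 1
      show ?case using assms lists_stored_cong[of "{1..N}" "L 1", OF L1] by (simp add: I_def)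
    next
      case (2 q s)
      then show ?case by (simp add: I_def)
    next
      case (3 q s)
      then have q: "1 \<le> q" "q * k \<le> N" "fmlookup s (''m'', []) = Some (q * k)"
        "fmlookup s (''k'', []) = Some k" "bounded_store N s" and ls: "lists_stored {1..N} (L q) s"
        by (auto simp: I_def)
      have qk: "Suc 0 \<le> q * k" using q assms by simp
      have len: "fmlookup s (''Len'', [q * k]) = Some (length (L q (q * k)))"
        using ls q qk by (auto simp: lists_stored_def)
      have "L q (q * k) = divisors_below k (q * k)" by (simp add: L_def)
      then have less: "length (L q (q * k)) < length (divisors_below (Suc N) (q * k))"
        using length_divisors_below_less[of k N "q * k"] assms by simp
      also have "\<dots> \<le> N" using length_divisors_below_le[of "Suc N" "q * k"] by simp
      finally have le: "length (L q (q * k)) < N" .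
      have upd: "lists_stored {1..N} (L (Suc q)) (fmupd (''Len'', [q * k]) (Suc (length (L q (q * k))))
          (fmupd (''Divs'', [q * k, length (L q (q * k))]) k s))"
        using lists_stored_append[OF ls _ L_Suc] q qk by simp
      have "q \<le> N" by (rule order.trans[OF _ q(2)]) (use assms in simp)
      then show ?case using q qk len less le upd assms by (simp add: wp_simps I_def add.commute)
    next
      case (4 q t s)
      then have "N < q * k" by (auto simp: I_def)
      then have "lists_stored {1..N} (L q) s = lists_stored {1..N} (divisors_below (Suc k)) s"
        by (intro lists_stored_cong LN)
      then show ?case using 4 by (simp add: I_def)
    qed
  qed (use assms in auto)
qed

text \<open>Round \<open>k\<close> makes only about \<open>N div k\<close> steps, but charging O(N)
  for it loses nothing in the end, since computing all the values \<open>S\<close> is quadratic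
  anyway.\<close>

lemma build_divisor_lists:
  assumes "bounded_store N s" "N \<ge> 1"
  shows "wp (space_bound N) build_divisor_lists
    (\<lambda>t s'. t \<le> (10 * N + 10) * N + 10 * N + 10 \<and> bounded_store N s' \<and> divisors_stored N s') s"
proof -
  \<comment> \<open>The counter leaves the loop at \<open>N + 1\<close>; for \<open>N = 1\<close>
    this is already its start value \<open>2\<close>.\<close>
  define I where "I k s \<longleftrightarrow> bounded_store N s \<and> 2 \<le> k \<and> (k \<le> N \<or> k = max 2 (N + 1)) \<and>
    fmlookup s (''k'', []) = Some k \<and> lists_stored {1..N} (divisors_below k) s" for k s
  let ?init = "''m'' ::= Num 1 ;;
    While (Leq (Var ''m'') (Var ''N'')) (
      Assign ''Divs'' [Var ''m'', Num 0] (Num 1) ;;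
      Assign ''Len'' [Var ''m''] (Num 1) ;;
      ''m'' ::= Plus (Var ''m'') (Num 1))"
  \<comment> \<open>\<open>;;\<close> nests to the right, whereas the two preceding lemmas treat an
    assignment together with the loop after it; regrouping exposes that prefix.\<close>
  have assoc: "wp M (c1 ;; c2 ;; c3) Q = wp M ((c1 ;; c2) ;; c3) Q" for M c1 c2 c3 Q
    by (simp add: wp_Seq add.assoc)
  show ?thesis
    unfolding build_divisor_lists_def assoc[of _ "''m'' ::= Num 1"]
    unfolding wp_Seq[of _ ?init]
  proof (rule wp_mono[OF initialise_lists[OF assms]], goal_cases)
    case (1 t0 s0)
    then have t0: "t0 \<le> 10 * N + 1" and s0: "bounded_store N s0" "lists_stored {1..N} (divisors_below 2) s0"
      by auto
    show ?case
      unfolding wp_Seq[of _ "''k'' ::= _"] wp_Assign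
    proof (intro conjI, goal_cases)
      case 3
      show ?case
      proof (rule wp_While[where I = I and j = 2 and J = "N + 1" and C = "10 * N + 10"], goal_cases)
        case 1
        show ?case using s0 assms by (auto simp: I_def)
      next
        case (2 k s)
        then show ?case by (simp add: I_def)
      next
        case (3 k s)
        then have k: "bounded_store N s" "2 \<le> k" "k \<le> N" "fmlookup s (''k'', []) = Some k"
          "lists_stored {1..N} (divisors_below k) s"
          by (auto simp: I_def)
        show ?case
          unfolding assoc[of _ "''m'' ::= _"] wp_Seq[of _ "''m'' ::= _ ;; _"]
        proof (intro conjI wp_mono[OF append_divisor[OF k]], goal_cases)
          case (2 t s)
          then show ?case using k by (auto simp: wp_simps I_def)
        qed (use k in simp)
      next
        case (4 k t s)
        then have k: "k = max 2 (N + 1)" by (auto simp: I_def)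
        have "(10 * N + 10) * (N + 1 - 2) \<le> (10 * N + 10) * N" by (rule mult_le_mono2) simp
        moreover have "t \<le> (10 * N + 10) * (N + 1 - 2) + 1" using 4 by simp
        ultimately have "t0 + t \<le> (10 * N + 10) * N + 10 * N + 2" using t0 by linarith
        moreover have "k = Suc N" using k assms by simp
        ultimately show ?case using 4 by (simp add: I_def)
      qed
    qed (use s0 assms in auto)
  qed
qed

section \<open>The table of complexities\<close>

definition table_upto :: "nat \<Rightarrow> store \<Rightarrow> bool" where
  "table_upto n s \<longleftrightarrow> (\<forall>j\<in>{1..<n}. fmlookup s (''Compl'', [j]) = Some (complexity j))"

lemma table_upto_lookup:
  "table_upto n s \<Longrightarrow> 1 \<le> j \<Longrightarrow> j < n \<Longrightarrow> fmlookup s (''Compl'', [j]) = Some (complexity j)"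
  by (simp add: table_upto_def)

lemma table_upto_update [simp]:
  "x \<noteq> ''Compl'' \<Longrightarrow> table_upto n (fmupd (x, is) v s) \<longleftrightarrow> table_upto n s"
  by (auto simp: table_upto_def)

lemma table_upto_Suc [simp]:
  "table_upto n s \<Longrightarrow> table_upto (Suc n) (fmupd (''Compl'', [n]) (complexity n) s)"
  by (auto simp: table_upto_def)

text \<open>The loops for \<open>S\<close> and \<open>P\<close> rely on this and preserve it, since
  they write only scalar variables other than \<open>N\<close> and \<open>n\<close>.\<close>

definition main_inv :: "nat \<Rightarrow> nat \<Rightarrow> store \<Rightarrow> bool" where
  "main_inv N n s \<longleftrightarrow> bounded_store N s \<and> divisors_stored N s \<and> table_upto n s \<and>
    fmlookup s (''n'', []) = Some n"

text \<open>\<open>S\<close> never drops below \<open>complexity n\<close> because each term of the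
  minimum is the cost of some expression for \<open>n\<close>. The bound \<open>2 * N\<close> serves
  the memory invariant.\<close>

lemma compute_S:
  assumes "main_inv N n s" "2 \<le> n" "n \<le> N"
  shows "wp (space_bound N) compute_S
    (\<lambda>t s'. t \<le> 10 * N + 20 \<and> main_inv N n s' \<and>
      (\<exists>S. fmlookup s' (''S'', []) = Some S \<and> complexity n \<le> S \<and> S \<le> 2 * N \<and>
        (\<forall>j. 1 \<le> j \<longrightarrow> j \<le> n div 2 \<longrightarrow> S \<le> complexity j + complexity (n - j)))) s"
proof -
  define I where "I k s \<longleftrightarrow> main_inv N n s \<and> 2 \<le> k \<and> k \<le> n div 2 + 1 \<and>
    fmlookup s (''k'', []) = Some k \<and>
    (\<exists>S. fmlookup s (''S'', []) = Some S \<and> complexity n \<le> S \<and> S \<le> 2 * N \<and>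
      (\<forall>j. 1 \<le> j \<longrightarrow> j < k \<longrightarrow> S \<le> complexity j + complexity (n - j)))" for k s
  have sum: "complexity n \<le> complexity j + complexity (n - j)"
    "complexity j + complexity (n - j) \<le> 2 * N" if "1 \<le> j" "j < n" for j
    using complexity_add_le[of j "n - j"] complexity_le_self[of j] complexity_le_self[of "n - j"]
      that assms by simp_all
  have s: "bounded_store N s" "divisors_stored N s" "table_upto n s" "fmlookup s (''n'', []) = Some n"
    using assms by (auto simp: main_inv_def)
  have c: "fmlookup s (''Compl'', [1]) = Some (complexity 1)"
    "fmlookup s (''Compl'', [n - 1]) = Some (complexity (n - 1))"
    using s assms by (auto intro!: table_upto_lookup)
  have first: "complexity n \<le> complexity 1 + complexity (n - 1)"
    "complexity 1 + complexity (n - 1) \<le> 2 * N" using sum[of 1] assms by auto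
  show ?thesis
    unfolding compute_S_def wp_Seq[of _ "''S'' ::= _"] wp_Seq[of _ "''k'' ::= _"] wp_Assign
  proof (intro conjI, goal_cases)
    case 5
    show ?case
    proof (rule wp_While[where I = I and j = 2 and J = "N + 1" and C = 10], goal_cases)
      case 1
      have one: "j = Suc 0" if "Suc 0 \<le> j" "j < 2" for j using that by simp
      show ?case using assms s c first by (auto simp: I_def main_inv_def dest!: one)
    next
      case (2 k s)
      then show ?case by (simp add: I_def main_inv_def)
    next
      case (3 k s)
      then obtain S where k: "bounded_store N s" "divisors_stored N s" "table_upto n s"
          "fmlookup s (''n'', []) = Some n" "2 \<le> k" "k \<le> n div 2" "fmlookup s (''k'', []) = Some k"
        and S: "fmlookup s (''S'', []) = Some S" "complexity n \<le> S" "S \<le> 2 * N"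
          "\<And>j. 1 \<le> j \<Longrightarrow> j < k \<Longrightarrow> S \<le> complexity j + complexity (n - j)"
        by (auto simp: I_def main_inv_def)
      have c: "fmlookup s (''Compl'', [k]) = Some (complexity k)"
        "fmlookup s (''Compl'', [n - k]) = Some (complexity (n - k))"
        using k by (auto intro!: table_upto_lookup)
      have kn: "k < n" using k by simp
      note sums = sum[of k]
      \<comment> \<open>\<open>T\<close> stands for the value of \<open>S\<close> after the round,
        so that both branches of the conditional are instances.\<close>
      have step: "\<forall>j. Suc 0 \<le> j \<longrightarrow> j < Suc k \<longrightarrow> T \<le> complexity j + complexity (n - j)"
        if "T \<le> S" "T \<le> complexity k + complexity (n - k)" for T
        using S(4) that by (fastforce simp: less_Suc_eq)
      show ?case
        using k c kn sums S(1-3) assms step[of S] step[of "complexity k + complexity (n - k)"]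
        by (simp add: wp_simps I_def main_inv_def)
    next
      case (4 k t s)
      then have k: "k = n div 2 + 1" by (auto simp: I_def main_inv_def)
      show ?case using 4 unfolding k by (auto simp: I_def main_inv_def less_Suc_eq_le)
    qed
  qed (use assms s c first in auto)
qed

text \<open>\<open>S\<close> is carried through because it is compared with \<open>P\<close> only
  afterwards. If \<open>n\<close> is prime, \<open>P\<close> keeps its start value
  \<open>N + 1\<close>, which exceeds \<open>complexity n\<close>.\<close>

lemma compute_P:
  assumes "main_inv N n s" "2 \<le> n" "n \<le> N" "fmlookup s (''S'', []) = Some S"
  shows "wp (space_bound N) compute_P
    (\<lambda>t s'. t \<le> 15 * N + 20 \<and> main_inv N n s' \<and> fmlookup s' (''S'', []) = Some S \<and>
      (\<exists>P. fmlookup s' (''P'', []) = Some P \<and> complexity n \<le> P \<and>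
        (\<forall>d. 1 < d \<longrightarrow> d < n \<longrightarrow> d dvd n \<longrightarrow> P \<le> complexity d + complexity (n div d)))) s"
proof -
  define D where "D = divisors_below (Suc N) n"
  define I where "I i s \<longleftrightarrow> main_inv N n s \<and> fmlookup s (''S'', []) = Some S \<and> i \<le> length D \<and>
    fmlookup s (''i'', []) = Some i \<and>
    (\<exists>P. fmlookup s (''P'', []) = Some P \<and> complexity n \<le> P \<and> P \<le> N + 1 \<and>
      (\<forall>j<i. 1 < D ! j \<longrightarrow> D ! j < n \<longrightarrow>
        P \<le> complexity (D ! j) + complexity (n div D ! j)))" for i s
  have len: "length D \<le> N"
    using length_divisors_below_le[of "Suc N" n] by (simp add: D_def)
  have D: "1 \<le> D ! i" "D ! i \<le> N" "D ! i dvd n" if "i < length D" for i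
    using divisors_below_nth[of i "Suc N" n] that by (auto simp: D_def)
  \<comment> \<open>The cofactor of a divisor \<open>d > 1\<close> is a positive number below
    \<open>n\<close>, so its table entry is ready when it is read.\<close>
  have quot: "1 \<le> n div d \<and> n div d < n" if "1 < d" "d dvd n" for d
    using that assms by (auto simp: div_greater_zero_iff Suc_le_eq dvd_imp_le)
  have prod: "complexity n \<le> complexity d + complexity (n div d)" if "1 < d" "d dvd n" for d
    using complexity_mult_le[of d "n div d"] quot[OF that] that by simp
  have le: "complexity n \<le> N" using complexity_le_self[of n] assms by simp
  have lists: "fmlookup s (''Len'', [n]) = Some (length D)"
    "\<And>i. i < length D \<Longrightarrow> fmlookup s (''Divs'', [n, i]) = Some (D ! i)"
    if "main_inv N n s" for s
    using that assms by (auto simp: main_inv_def lists_stored_def D_def)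
  have s: "bounded_store N s" "divisors_stored N s" "table_upto n s" "fmlookup s (''n'', []) = Some n"
    using assms by (auto simp: main_inv_def)
  show ?thesis
    unfolding compute_P_def wp_Seq[of _ "''P'' ::= _"] wp_Seq[of _ "''i'' ::= _"] wp_Assign
  proof (intro conjI, goal_cases)
    case 5
    show ?case
    proof (rule wp_While[where I = I and j = 0 and J = N and C = 15], goal_cases)
      case 1
      show ?case using assms s le by (auto simp: I_def main_inv_def)
    next
      case (2 i s)
      then show ?case by (simp add: I_def main_inv_def)
    next
      case (3 i s)
      then have inv: "main_inv N n s" by (simp add: I_def)
      from 3 obtain P where i: "bounded_store N s" "divisors_stored N s" "table_upto n s"
          "fmlookup s (''n'', []) = Some n" "fmlookup s (''i'', []) = Some i"
          "fmlookup s (''S'', []) = Some S"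
          and il: "i < length D"
        and P: "fmlookup s (''P'', []) = Some P" "complexity n \<le> P" "P \<le> N + 1"
          "\<And>j. j < i \<Longrightarrow> 1 < D ! j \<Longrightarrow> D ! j < n \<Longrightarrow>
            P \<le> complexity (D ! j) + complexity (n div D ! j)"
        using lists[OF inv] by (auto simp: I_def main_inv_def)
      define d where "d = D ! i"
      have d: "fmlookup s (''Divs'', [n, i]) = Some d" "d dvd n" "d \<le> N"
        using lists[OF inv] D il by (auto simp: d_def)
      have step: "\<forall>j<Suc i. Suc 0 < D ! j \<longrightarrow> D ! j < n \<longrightarrow>
          T \<le> complexity (D ! j) + complexity (n div D ! j)"
        if "T \<le> P" "1 < d \<Longrightarrow> d < n \<Longrightarrow> T \<le> complexity d + complexity (n div d)" for T
        using P(4) that by (fastforce simp: less_Suc_eq d_def)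
      show ?case
      proof (cases "1 < d \<and> d < n")
        case True
        have c: "fmlookup s (''Compl'', [d]) = Some (complexity d)"
          "fmlookup s (''Compl'', [n div d]) = Some (complexity (n div d))"
          using True i quot[of d] d by (auto intro!: table_upto_lookup)
        have "complexity d \<le> N" "complexity (n div d) \<le> N"
          using complexity_le_self[of d] complexity_le_self[of "n div d"] quot[of d] True d assms
          by linarith+
        then have "complexity d + complexity (n div d) \<le> 2 * N" by simp
        then show ?thesis
          using True i il len d c P(1-3) assms prod[of d] step[of P]
            step[of "complexity d + complexity (n div d)"]
          by (simp add: wp_simps I_def main_inv_def)
      next
        \<comment> \<open>Here \<open>d\<close> is \<open>1\<close> or \<open>n\<close>:
          \<open>P\<close> stays as it is, and the claim for the new position is vacuous.\<close>
        case False
        then show ?thesis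
          using i il len d P(1-3) assms step[of P] by (auto simp: wp_simps I_def main_inv_def)
      qed
    next
      case (4 i t s)
      then have inv: "main_inv N n s" and "i = length D"
        using lists(1)[of s] by (auto simp: I_def main_inv_def)
      with 4 obtain P where P: "fmlookup s (''P'', []) = Some P" "complexity n \<le> P"
        "\<And>j. j < length D \<Longrightarrow> 1 < D ! j \<Longrightarrow> D ! j < n \<Longrightarrow>
            P \<le> complexity (D ! j) + complexity (n div D ! j)"
        by (auto simp: I_def)
      have "P \<le> complexity d + complexity (n div d)" if d: "1 < d" "d < n" "d dvd n" for d
      proof -
        \<comment> \<open>The invariant speaks of list positions; as \<open>n <= N\<close>, every
          proper divisor of \<open>n\<close> occupies one.\<close>
        obtain j where "j < length D" "D ! j = d"
          unfolding D_def by (rule divisors_below_index[of d "Suc N" n]) (use d assms in auto)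
        then show ?thesis using P(3)[of j] d by simp
      qed
      then show ?case using 4 inv P(1,2) by (simp add: I_def)
    qed
  qed (use assms s in auto)
qed

section \<open>The main loop and the total cost\<close>

lemma brute_force_correct:
  assumes "N \<ge> 1"
  shows "wp (space_bound N) brute_force
    (\<lambda>t s. t \<le> 100 * (N + 1)\<^sup>2 \<and> table_upto (N + 1) s) (input_store N)"
proof -
  have init: "bounded_store N (input_store N)"
    by (simp add: bounded_store_def input_store_def fmpred_upd)
  define I where "I n s \<longleftrightarrow> main_inv N n s \<and> 2 \<le> n \<and> n \<le> max 2 (N + 1)" for n s
  show ?thesis
    unfolding brute_force_def wp_Seq[of _ build_divisor_lists]
  proof (rule wp_mono[OF build_divisor_lists[OF init assms]], goal_cases)
    case (1 t0 s0)
    then have t0: "t0 \<le> (10 * N + 10) * N + 10 * N + 10"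
      and s0: "bounded_store N s0" "divisors_stored N s0" by auto
    show ?case
      unfolding wp_Seq[of _ "Assign ''Compl'' _ _"] wp_Seq[of _ "''n'' ::= _"] wp_Assign
    proof (intro conjI, goal_cases)
      case 5
      show ?case
      \<comment> \<open>The two inner computations cost at most \<open>25 * N + 40\<close>; the
        remaining 10 cover the guard, the comparison of \<open>S\<close> with \<open>P\<close> and
        the last two assignments.\<close>
      proof (rule wp_While[where I = I and j = 2 and J = "N + 1" and C = "25 * N + 50"], goal_cases)
        case 1
        have one: "j = Suc 0" if "Suc 0 \<le> j" "j < 2" for j using that by simp
        show ?case using s0 assms complexity_1
          by (auto simp: I_def main_inv_def table_upto_def dest!: one)
      next
        case (2 n s)
        then show ?case by (simp add: I_def main_inv_def)
      next
        case (3 n s)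
        then have n: "main_inv N n s" "2 \<le> n" "n \<le> N" by (auto simp: I_def main_inv_def)
        have "wp (space_bound N) (compute_S ;; compute_P ;;
            If (Less (Var ''S'') (Var ''P''))
              (Assign ''Compl'' [Var ''n''] (Var ''S''))
              (Assign ''Compl'' [Var ''n''] (Var ''P'')) ;;
            ''n'' ::= Plus (Var ''n'') (Num 1))
          (\<lambda>t s'. 1 + t \<le> 25 * N + 50 \<and> I (Suc n) s') s"
          unfolding wp_Seq[of _ compute_S]
        proof (rule wp_mono[OF compute_S[OF n]], goal_cases)
          case (1 t1 s1)
          then obtain S where t1: "t1 \<le> 10 * N + 20" and s1: "main_inv N n s1"
              "fmlookup s1 (''S'', []) = Some S"
            and S: "complexity n \<le> S" "S \<le> 2 * N"
              "\<And>j. 1 \<le> j \<Longrightarrow> j \<le> n div 2 \<Longrightarrow> S \<le> complexity j + complexity (n - j)"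
            by auto
          show ?case
            unfolding wp_Seq[of _ compute_P]
          proof (rule wp_mono[OF compute_P[OF s1(1) n(2,3) s1(2)]], goal_cases)
            case (1 t2 s2)
            then obtain P where t2: "t2 \<le> 15 * N + 20" and s2: "main_inv N n s2"
                "fmlookup s2 (''S'', []) = Some S" "fmlookup s2 (''P'', []) = Some P"
              and P: "complexity n \<le> P"
                "\<And>d. 1 < d \<Longrightarrow> d < n \<Longrightarrow> d dvd n \<Longrightarrow> P \<le> complexity d + complexity (n div d)"
              by auto
            \<comment> \<open>Neither value falls below \<open>complexity n\<close>, and an optimal
              decomposition of \<open>n\<close> supplies a term that forces one of them down to
              it.\<close>
            have eq: "min S P = complexity n"
              using n(2)
            proof (cases rule: complexity_cases)
              case (add k)
              then show ?thesis using S(1) S(3)[of k] P(1) by simp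
            next
              case (mult d)
              then show ?thesis using S(1) P(1) P(2)[of d] by simp
            qed
            have le: "complexity n \<le> N" using complexity_le_self[of n] n by simp
            show ?case
            proof (cases "S < P")
              case True
              then have "S = complexity n" using eq by simp
              then show ?thesis using True s2 n t1 t2 le
                by (simp add: wp_simps I_def main_inv_def)
            next
              case False
              then have "P = complexity n" using eq by simp
              then show ?thesis using False s2 n t1 t2 le
                by (simp add: wp_simps I_def main_inv_def)
            qed
          qed
        qed
        then show ?case using n by simp
      next
        case (4 n t s)
        then have n: "n = max 2 (N + 1)" by (auto simp: I_def main_inv_def)
        have "(25 * N + 50) * (N + 1 - 2) \<le> (25 * N + 50) * N" by (rule mult_le_mono2) simp
        moreover have "t \<le> (25 * N + 50) * (N + 1 - 2) + 1" using 4 by simp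
        ultimately have "t0 + (t + 10) \<le> (35 * N + 60) * N + 10 * N + 30" using t0
          by (simp add: algebra_simps)
        also have "\<dots> \<le> 100 * (N + 1)\<^sup>2" by (simp add: power2_eq_square algebra_simps)
        finally show ?case using 4 n assms by (simp add: I_def main_inv_def)
      qed
    qed (use s0 assms in auto)
  qed
qed

theorem proposition1:
  shows "\<exists>(final :: nat \<Rightarrow> store) (time :: nat \<Rightarrow> nat) (space :: nat \<Rightarrow> nat).
    (\<forall>N\<ge>1. exec brute_force (input_store N) (time N) (space N) (final N)) \<and>
    (\<forall>N\<ge>1. \<forall>n\<in>{1..N}. fmlookup (final N) (''Compl'', [n]) = Some (complexity n)) \<and>
    (\<lambda>N. real (time N)) \<in> O(\<lambda>N. (real N)\<^sup>2) \<and>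
    (\<lambda>N. real (space N)) \<in> O(\<lambda>N. real N * (ln (real N))\<^sup>2)"
proof -
  have "\<forall>N\<ge>1. \<exists>t m s. exec brute_force (input_store N) t m s \<and>
      m \<le> space_bound N \<and> t \<le> 100 * (N + 1)\<^sup>2 \<and> table_upto (N + 1) s"
    using brute_force_correct unfolding wp_def by blast
  \<comment> \<open>The choice leaves the values at \<open>N = 0\<close> arbitrary, where the write
    to \<open>Compl[1]\<close> would fall outside \<open>cells N\<close>; the Landau bounds ignore
    that point.\<close>
  then obtain time space final where run: "\<And>N. N \<ge> 1 \<Longrightarrow>
      exec brute_force (input_store N) (time N) (space N) (final N) \<and>
      space N \<le> space_bound N \<and> time N \<le> 100 * (N + 1)\<^sup>2 \<and> table_upto (N + 1) (final N)"
    by metis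
  have "(\<lambda>N. real (time N)) \<in> O(\<lambda>N. real (100 * (N + 1)\<^sup>2))"
    by (intro bigoI[of _ 1] eventually_mono[OF eventually_ge_at_top[of 1]])
       (use run in \<open>simp del: of_nat_mult of_nat_power\<close>)
  also have "(\<lambda>N. real (100 * (N + 1)\<^sup>2)) \<in> O(\<lambda>N. (real N)\<^sup>2)"
    unfolding of_nat_mult of_nat_power of_nat_add by real_asymp
  finally have time: "(\<lambda>N. real (time N)) \<in> O(\<lambda>N. (real N)\<^sup>2)" .
  have "(\<lambda>N. real (space N)) \<in> O(\<lambda>N. real (space_bound N))"
    by (intro bigoI[of _ 1] eventually_mono[OF eventually_ge_at_top[of 1]]) (use run in simp)
  from landau_o.big_trans[OF this space_bound_bigo]
  have space: "(\<lambda>N. real (space N)) \<in> O(\<lambda>N. real N * (ln (real N))\<^sup>2)" .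
  show ?thesis
    by (rule exI[of _ final], rule exI[of _ time], rule exI[of _ space])
      (use run time space in \<open>auto intro!: table_upto_lookup[of "Suc _"]\<close>)
qed

end
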